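(* Let $\mathcal{G}=(A,B;S,T)$ be a constrained bi-matrix game with optimal value functions $\eta$ and $\xi$. Then $$\operatorname{epi}\eta=(T\times\mathbb{R})\cap\begin{pmatrix}A&0\\0&-1\end{pmatrix}^{-1}\bigl[(S\times\{1\})^*\bigr]$$ and $$\operatorname{epi}\xi=(S\times\mathbb{R})\cap\begin{pmatrix}B^{\top}&0\\0&-1\end{pmatrix}^{-1}\bigl[(T\times\{1\})^*\bigr].$$
   Context: A constrained bi-matrix game $\mathcal{G}=(A,B;S,T)$ consists of $A,B\in\mathbb{R}^{m\times n}$ and nonempty convex polytopes $S\subseteq\mathbb{R}^m$, $T\subseteq\mathbb{R}^n$. The optimal value functions are $\eta:\mathbb{R}^n\to\mathbb{R}\cup\{\infty\}$, $\eta(y)=\max_{x\in S}y^{\top}A^{\top}x$ if $y\in T$ and $\infty$ otherwise, and $\xi:\mathbb{R}^m\to\mathbb{R}\cup\{\infty\}$, $\xi(x)=\max_{y\in T}x^{\top}By$ if $x\in S$ and $\infty$ otherwise. $\operatorname{epi}$ denotes the epigraph. For a set $P\subseteq\mathbb{R}^q$, the polar cone is $P^*=\{y\in\mathbb{R}^q\mid y^{\top}x\le 0\ \text{for all }x\in P\}$. For a matrix $M$, $M^{-1}[Q]=\{x\mid Mx\in Q\}$ is the inverse image under the linear map $M$ ($M$ need not be invertible). *)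

theory Defs
  imports "HOL-Analysis.Analysis"
begin

text \<open>An \<open>m \<times> n\<close> matrix has type \<^typ>\<open>real ^ 'n ^ 'm\<close>.  The space of dimension \<open>n + 1\<close> is
  \<^typ>\<open>real ^ ('n + 1)\<close>, with \<open>Inl\<close> indexing the first \<open>n\<close> coordinates.\<close>

definition append_coord :: "real ^ 'n \<Rightarrow> real \<Rightarrow> real ^ ('n + 1)" where
  "append_coord x r = (\<chi> i. case i of Inl j \<Rightarrow> x $ j | Inr _ \<Rightarrow> r)"

definition vec_Times :: "(real ^ 'n) set \<Rightarrow> real set \<Rightarrow> (real ^ ('n + 1)) set" where
  "vec_Times P R = {append_coord x r | x r. x \<in> P \<and> r \<in> R}"

definition epi :: "(real ^ 'n \<Rightarrow> ereal) \<Rightarrow> (real ^ ('n + 1)) set" where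
  "epi f = {append_coord x r | x r. f x \<le> ereal r}"

definition polar_cone :: "(real ^ 'q) set \<Rightarrow> (real ^ 'q) set" where
  "polar_cone P = {y. \<forall>x\<in>P. y \<bullet> x \<le> 0}"

definition block_matrix ::
  "real ^ 'n ^ 'm \<Rightarrow> real ^ 'k ^ 'm \<Rightarrow> real ^ 'n ^ 'p \<Rightarrow> real ^ 'k ^ 'p \<Rightarrow>
    real ^ ('n + 'k) ^ ('m + 'p)" where
  "block_matrix M11 M12 M21 M22 = (\<chi> i j.
     case i of
       Inl a \<Rightarrow> (case j of Inl b \<Rightarrow> M11 $ a $ b | Inr b \<Rightarrow> M12 $ a $ b)
     | Inr a \<Rightarrow> (case j of Inl b \<Rightarrow> M21 $ a $ b | Inr b \<Rightarrow> M22 $ a $ b))"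

definition inverse_image :: "real ^ 'n ^ 'm \<Rightarrow> (real ^ 'm) set \<Rightarrow> (real ^ 'n) set" where
  "inverse_image M Q = {x. M *v x \<in> Q}"

text \<open>The maxima in the optimal value functions are written as suprema in \<^typ>\<open>ereal\<close>.  They are
  attained when the set is a nonempty polytope; see \<open>opt_val_x_attained\<close> and
  \<open>opt_val_y_attained\<close> below.\<close>

definition opt_val_x ::
  "real ^ 'n ^ 'm \<Rightarrow> (real ^ 'm) set \<Rightarrow> (real ^ 'n) set \<Rightarrow> real ^ 'n \<Rightarrow> ereal" where
  "opt_val_x A S T y =
     (if y \<in> T then SUP x\<in>S. ereal (y \<bullet> (transpose A *v x)) else \<infinity>)"

definition opt_val_y ::
  "real ^ 'n ^ 'm \<Rightarrow> (real ^ 'm) set \<Rightarrow> (real ^ 'n) set \<Rightarrow> real ^ 'm \<Rightarrow> ereal" where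
  "opt_val_y B S T x =
     (if x \<in> S then SUP y\<in>T. ereal (x \<bullet> (B *v y)) else \<infinity>)"

lemma SUP_linear_attained:
  fixes P :: "(real ^ 'k) set" and M :: "real ^ 'k ^ 'l" and c :: "real ^ 'l"
  assumes "polytope P" "P \<noteq> {}"
  shows "\<exists>p\<in>P. (SUP q\<in>P. ereal (c \<bullet> (M *v q))) = ereal (c \<bullet> (M *v p))
    \<and> (\<forall>q\<in>P. c \<bullet> (M *v q) \<le> c \<bullet> (M *v p))"
proof -
  have "continuous_on P (\<lambda>q. c \<bullet> (M *v q))"
    by (intro continuous_intros matrix_vector_mult_linear_continuous_on)
  then obtain p where "p \<in> P" and max: "\<forall>q\<in>P. c \<bullet> (M *v q) \<le> c \<bullet> (M *v p)"
    using continuous_attains_sup[OF polytope_imp_compact[OF assms(1)] assms(2)] by blast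
  moreover have "(SUP q\<in>P. ereal (c \<bullet> (M *v q))) = ereal (c \<bullet> (M *v p))"
    by (intro antisym SUP_least SUP_upper) (use \<open>p \<in> P\<close> max in auto)
  ultimately show ?thesis by blast
qed

lemma opt_val_x_attained:
  assumes "polytope S" "S \<noteq> {}" "y \<in> T"
  shows "\<exists>x\<in>S. opt_val_x A S T y = ereal (y \<bullet> (transpose A *v x))
    \<and> (\<forall>x'\<in>S. y \<bullet> (transpose A *v x') \<le> y \<bullet> (transpose A *v x))"
  using SUP_linear_attained[OF assms(1,2)] assms(3) unfolding opt_val_x_def by (simp only: if_True)

lemma opt_val_y_attained:
  assumes "polytope T" "T \<noteq> {}" "x \<in> S"
  shows "\<exists>y\<in>T. opt_val_y B S T x = ereal (x \<bullet> (B *v y))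
    \<and> (\<forall>y'\<in>T. x \<bullet> (B *v y') \<le> x \<bullet> (B *v y))"
  using SUP_linear_attained[OF assms(1,2)] assms(3) unfolding opt_val_y_def by (simp only: if_True)

end

theory Submission
  imports Defs
begin

text \<open>A supremum is at most \<open>r\<close> iff all its members are, so \<open>(y, r)\<close>
  lies in the epigraph of \<eta> iff \<open>y \<in> T\<close> and
  \<open>(A *v y) \<bullet> x \<le> r\<close> for every \<open>x \<in> S\<close>. The latter says
  that \<open>(A *v y, -r)\<close> has nonpositive inner product with each \<open>(x, 1)\<close>,
  which is membership in the polar cone after applying the block matrix
  (\<open>opt_val_x_le_iff\<close>, \<open>append_coord_mem_polar_cone_iff\<close>). The formula for
  \<xi> follows by exchanging the players.\<close>

lemma sum_UNIV_Plus:
  fixes f :: "'a::finite + 'b::finite \<Rightarrow> 'c::comm_monoid_add"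
  shows "sum f UNIV = (\<Sum>a\<in>UNIV. f (Inl a)) + (\<Sum>b\<in>UNIV. f (Inr b))"
  unfolding UNIV_Plus_UNIV[symmetric] by (subst sum.Plus) (simp_all add: comp_def)

lemma inner_append_coord: "append_coord x r \<bullet> append_coord y s = x \<bullet> y + r * s"
  by (simp add: inner_vec_def sum_UNIV_Plus append_coord_def)

lemma append_coord_eqI:
  assumes "\<And>j. v $ Inl j = x $ j" and "v $ Inr 1 = r"
  shows "v = append_coord x r"
proof -
  \<comment> \<open>The index type \<open>1\<close> has a single element, so the value at
    \<open>Inr 1\<close> settles every \<open>Inr k\<close>.\<close>
  have "v $ Inr k = r" for k :: 1
    using assms(2) by (metis num1_eq1)
  with assms(1) show ?thesis
    by (simp add: vec_eq_iff append_coord_def split: sum.split)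
qed

lemma append_coord_eq_iff [simp]:
  "append_coord x r = append_coord y s \<longleftrightarrow> x = y \<and> r = s"
proof
  assume eq: "append_coord x r = append_coord y s"
  have "append_coord x r $ Inl j = append_coord y s $ Inl j" for j
    by (simp only: eq)
  moreover have "append_coord x r $ Inr 1 = append_coord y s $ Inr 1"
    by (simp only: eq)
  ultimately show "x = y \<and> r = s"
    by (simp add: append_coord_def vec_eq_iff)
qed simp

lemma block_matrix_mult_append_coord:
  "block_matrix A 0 0 (- mat 1) *v append_coord y r = append_coord (A *v y) (- r)"
  by (rule append_coord_eqI)
    (simp_all add: matrix_vector_mult_def sum_UNIV_Plus block_matrix_def append_coord_def mat_def)

text \<open>Homogenization: the extra coordinate 1 absorbs the bound \<open>r\<close> into a linear
  inequality with right-hand side 0.\<close>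

lemma append_coord_mem_polar_cone_iff:
  "append_coord v (- r) \<in> polar_cone (vec_Times P {1}) \<longleftrightarrow> (\<forall>x\<in>P. v \<bullet> x \<le> r)"
  by (auto simp: polar_cone_def vec_Times_def inner_append_coord)

text \<open>Outside \<open>T\<close> the value is \<infinity>, which no real \<open>r\<close>
  bounds; this yields the conjunct \<open>y \<in> T\<close>.\<close>

lemma opt_val_x_le_iff:
  "opt_val_x A S T y \<le> ereal r \<longleftrightarrow> y \<in> T \<and> (\<forall>x\<in>S. (A *v y) \<bullet> x \<le> r)"
proof -
  have "y \<bullet> (transpose A *v x) = (A *v y) \<bullet> x" for x
    by (metis dot_lmul_matrix inner_commute transpose_matrix_vector)
  then show ?thesis
    by (simp add: opt_val_x_def SUP_le_iff)
qed

lemma epi_opt_val_x: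
  "epi (opt_val_x A S T) =
    vec_Times T UNIV \<inter>
    inverse_image (block_matrix A 0 0 (- mat 1)) (polar_cone (vec_Times S {1}))"
  \<comment> \<open>Only the product with \<open>T\<close> is unfolded; the one inside the polar
    cone stays folded for the homogenization lemma.\<close>
  by (auto simp: epi_def vec_Times_def[of T] inverse_image_def opt_val_x_le_iff
      block_matrix_mult_append_coord append_coord_mem_polar_cone_iff)

text \<open>Swapping the players transposes the payoff matrix, and the double transpose
  cancels.\<close>

lemma opt_val_y_eq_opt_val_x_transpose: "opt_val_y B S T = opt_val_x (transpose B) T S"
  by (simp add: fun_eq_iff opt_val_y_def opt_val_x_def)

theorem mainTheorem5:
  fixes A B :: "real ^ 'n ^ 'm"
    and S :: "(real ^ 'm) set" and T :: "(real ^ 'n) set"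
  assumes "polytope S" and "S \<noteq> {}" and "polytope T" and "T \<noteq> {}"
  shows "epi (opt_val_x A S T) =
           vec_Times T UNIV \<inter>
           inverse_image (block_matrix A 0 0 (- mat 1)) (polar_cone (vec_Times S {1}))
       \<and> epi (opt_val_y B S T) =
           vec_Times S UNIV \<inter>
           inverse_image (block_matrix (transpose B) 0 0 (- mat 1)) (polar_cone (vec_Times T {1}))"
  by (simp add: epi_opt_val_x opt_val_y_eq_opt_val_x_transpose)

end
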